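(* Let $\mathfrak g=\mathfrak g_1\oplus\mathfrak g_2$ be a reducible finite-dimensional Lie algebra over $\mathbb K=\mathbb R$ or $\mathbb C$ (the direct sum of two nontrivial ideals $\mathfrak g_1,\mathfrak g_2$). Then $\mathfrak g$ is solitary if and only if $\mathfrak g_1$ and $\mathfrak g_2$ are solitary.
   Context: A metric on a Lie algebra $\mathfrak g$ is a nondegenerate symmetric $\mathbb K$-bilinear form $g$; it is ad-invariant if $g([X,Y],Z)=-g(Y,[X,Z])$ for all $X,Y,Z\in\mathfrak g$. A linear map $\phi\colon\mathfrak g\to\mathfrak g$ is ad-invariant if $\phi([X,Y])=[X,\phi(Y)]$ for all $X,Y$. For a linear map $f$, $f^{*_g}$ denotes its adjoint with respect to $g$. An ad-invariant metric $g$ is solitary if every ad-invariant $g$-self-adjoint linear map $\phi\colon\mathfrak g\to\mathfrak g$ can be written as $\phi=D+D^{*_g}$ for some derivation $D$ of $\mathfrak g$. A Lie algebra is solitary if it admits an ad-invariant metric and one (equivalently, every) ad-invariant metric on it is solitary. *)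

theory Defs
  imports Complex_Main
begin

text \<open>Fields isomorphic to \<open>\<real>\<close> or \<open>\<complex>\<close>; a multiplicative bijection automatically preserves \<open>1\<close>.\<close>

class real_or_complex = field +
  assumes real_or_complex:
    "(\<exists>f :: 'a \<Rightarrow> real. bij f \<and> (\<forall>x y. f (x + y) = f x + f y) \<and> (\<forall>x y. f (x * y) = f x * f y)) \<or>
     (\<exists>f :: 'a \<Rightarrow> complex. bij f \<and> (\<forall>x y. f (x + y) = f x + f y) \<and> (\<forall>x y. f (x * y) = f x * f y))"

instance real :: real_or_complex
  by standard (intro disjI1 exI[of _ id]; simp)

instance complex :: real_or_complex
  by standard (intro disjI2 exI[of _ id]; simp)

text \<open>
  The Lie algebra is the whole type \<open>'v\<close>. The notions below are relative to a carrier \<open>V\<close>,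
  meant to be a subalgebra and regarded as a Lie algebra under the restricted bracket;
  \<open>V = UNIV\<close> gives the ambient algebra. Maps and forms on \<open>V\<close> are functions on \<open>'v\<close> of
  which only the values at arguments in \<open>V\<close> matter.
\<close>

locale lie_algebra = vector_space scale
  for scale :: "'k::field \<Rightarrow> 'v::ab_group_add \<Rightarrow> 'v" +
  fixes bracket :: "'v \<Rightarrow> 'v \<Rightarrow> 'v"
  assumes bracket_linear_right: "Vector_Spaces.linear scale scale (\<lambda>y. bracket x y)"
    and bracket_linear_left: "Vector_Spaces.linear scale scale (\<lambda>x. bracket x y)"
    and bracket_self: "bracket x x = 0"
    and jacobi: "bracket x (bracket y z) + bracket y (bracket z x) + bracket z (bracket x y) = 0"
begin

definition lie_ideal :: "'v set \<Rightarrow> bool" where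
  "lie_ideal I \<longleftrightarrow> subspace I \<and> (\<forall>x. \<forall>y\<in>I. bracket x y \<in> I)"

definition endomorphism_on :: "'v set \<Rightarrow> ('v \<Rightarrow> 'v) \<Rightarrow> bool" where
  "endomorphism_on V f \<longleftrightarrow>
     (\<forall>x\<in>V. f x \<in> V) \<and>
     (\<forall>x\<in>V. \<forall>y\<in>V. f (x + y) = f x + f y) \<and>
     (\<forall>c. \<forall>x\<in>V. f (scale c x) = scale c (f x))"

definition metric_on :: "'v set \<Rightarrow> ('v \<Rightarrow> 'v \<Rightarrow> 'k) \<Rightarrow> bool" where
  "metric_on V g \<longleftrightarrow>
     (\<forall>x\<in>V. \<forall>y\<in>V. g x y = g y x) \<and>
     (\<forall>x\<in>V. \<forall>y\<in>V. \<forall>z\<in>V. g (x + y) z = g x z + g y z) \<and>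
     (\<forall>c. \<forall>x\<in>V. \<forall>y\<in>V. g (scale c x) y = c * g x y) \<and>
     (\<forall>x\<in>V. (\<forall>y\<in>V. g x y = 0) \<longrightarrow> x = 0)"

definition ad_invariant_metric_on :: "'v set \<Rightarrow> ('v \<Rightarrow> 'v \<Rightarrow> 'k) \<Rightarrow> bool" where
  "ad_invariant_metric_on V g \<longleftrightarrow>
     metric_on V g \<and>
     (\<forall>x\<in>V. \<forall>y\<in>V. \<forall>z\<in>V. g (bracket x y) z = - g y (bracket x z))"

definition ad_invariant_map_on :: "'v set \<Rightarrow> ('v \<Rightarrow> 'v) \<Rightarrow> bool" where
  "ad_invariant_map_on V f \<longleftrightarrow>
     endomorphism_on V f \<and> (\<forall>x\<in>V. \<forall>y\<in>V. f (bracket x y) = bracket x (f y))"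

definition derivation_on :: "'v set \<Rightarrow> ('v \<Rightarrow> 'v) \<Rightarrow> bool" where
  "derivation_on V D \<longleftrightarrow>
     endomorphism_on V D \<and>
     (\<forall>x\<in>V. \<forall>y\<in>V. D (bracket x y) = bracket (D x) y + bracket x (D y))"

text \<open>
  \<open>adjoint_on V g f f'\<close> says that \<open>f'\<close> is the \<open>g\<close>-adjoint of \<open>f\<close>; by nondegeneracy it is
  determined on \<open>V\<close>, see \<open>adjoint_on_unique\<close> below.
\<close>

definition adjoint_on ::
  "'v set \<Rightarrow> ('v \<Rightarrow> 'v \<Rightarrow> 'k) \<Rightarrow> ('v \<Rightarrow> 'v) \<Rightarrow> ('v \<Rightarrow> 'v) \<Rightarrow> bool" where
  "adjoint_on V g f f' \<longleftrightarrow>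
     endomorphism_on V f' \<and> (\<forall>x\<in>V. \<forall>y\<in>V. g (f x) y = g x (f' y))"

definition solitary_metric_on :: "'v set \<Rightarrow> ('v \<Rightarrow> 'v \<Rightarrow> 'k) \<Rightarrow> bool" where
  "solitary_metric_on V g \<longleftrightarrow>
     ad_invariant_metric_on V g \<and>
     (\<forall>f. ad_invariant_map_on V f \<and> adjoint_on V g f f \<longrightarrow>
        (\<exists>D D'. derivation_on V D \<and> adjoint_on V g D D' \<and> (\<forall>x\<in>V. f x = D x + D' x)))"

definition solitary_on :: "'v set \<Rightarrow> bool" where
  "solitary_on V \<longleftrightarrow> (\<exists>g. solitary_metric_on V g)"

lemma adjoint_on_unique:
  assumes V: "subspace V" and g: "metric_on V g"
    and 1: "adjoint_on V g f f1" and 2: "adjoint_on V g f f2" and x: "x \<in> V"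
  shows "f1 x = f2 x"
proof -
  have m: "f1 x \<in> V" "f2 x \<in> V"
    using 1 2 x by (auto simp: adjoint_on_def endomorphism_on_def)
  have d: "f1 x - f2 x \<in> V"
    using V m by (rule subspace_diff)
  have "g (f1 x - f2 x) y = 0" if y: "y \<in> V" for y
  proof -
    have "g (f1 x) y = g y (f1 x)" "g (f2 x) y = g y (f2 x)"
      using g m y unfolding metric_on_def by blast+
    moreover have "g y (f1 x) = g (f y) x" "g y (f2 x) = g (f y) x"
      using 1 2 x y unfolding adjoint_on_def by simp_all
    moreover have "g (f1 x - f2 x + f2 x) y = g (f1 x - f2 x) y + g (f2 x) y"
      using g d m y unfolding metric_on_def by blast
    ultimately show ?thesis by simp
  qed
  then have "f1 x - f2 x = 0"
    using g d unfolding metric_on_def by blast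
  then show ?thesis by simp
qed

end

end

(*
  If b(x, y) = c(T x, y) for two ad-invariant metrics, then T commutes with every ad X; composing
  a derivation with T gives a derivation, so whether all ad-invariant self-adjoint maps are of the
  form D + D^* does not depend on the metric. If each summand admits an ad-invariant metric,
  one may therefore use an orthogonal sum of such metrics, and split maps into blocks. The
  remaining point, that the summands inherit metrics at all, is not obvious because g1 and g2
  need not be orthogonal for a given metric on the sum.
*)
theory Submission
  imports Defs
begin

context lie_algebra
begin

section \<open>Elementary rules for brackets, metrics and ideals\<close>

lemma bracket_simps [simp]:
  "bracket (x + y) z = bracket x z + bracket y z"
  "bracket x (y + z) = bracket x y + bracket x z"
  "bracket (scale c x) y = scale c (bracket x y)"
  "bracket x (scale c y) = scale c (bracket x y)"
  "bracket 0 x = 0" "bracket x 0 = 0"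
  "bracket (- x) y = - bracket x y" "bracket x (- y) = - bracket x y"
proof -
  interpret l: Vector_Spaces.linear scale scale "\<lambda>y. bracket y z" for z
    by (rule bracket_linear_left)
  interpret r: Vector_Spaces.linear scale scale "\<lambda>y. bracket z y" for z
    by (rule bracket_linear_right)
  show "bracket (x + y) z = bracket x z + bracket y z"
    "bracket x (y + z) = bracket x y + bracket x z"
    "bracket (scale c x) y = scale c (bracket x y)"
    "bracket x (scale c y) = scale c (bracket x y)"
    "bracket 0 x = 0" "bracket x 0 = 0"
    "bracket (- x) y = - bracket x y" "bracket x (- y) = - bracket x y"
    by (rule l.add r.add l.scale r.scale l.zero r.zero l.neg r.neg)+
qed

text \<open>Polarization of \<open>bracket_self\<close> at \<open>x + y\<close>.\<close>

lemma bracket_commute: "bracket x y = - bracket y x"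
proof -
  have "bracket x y + bracket y x = bracket (x + y) (x + y) - bracket x x - bracket y y" by simp
  also have "\<dots> = 0" by (simp only: bracket_self diff_self)
  finally have "bracket x y + bracket y x = 0" .
  then show ?thesis by (simp add: eq_neg_iff_add_eq_0)
qed

text \<open>Symmetry stands first and nondegeneracy last, so that the items \<open>(2-11)\<close> in
  between are exactly the consequences of bilinearity.\<close>

lemma metric_onD:
  assumes "subspace V" "metric_on V g"
  shows "x \<in> V \<Longrightarrow> y \<in> V \<Longrightarrow> g x y = g y x"
    and "x \<in> V \<Longrightarrow> y \<in> V \<Longrightarrow> z \<in> V \<Longrightarrow> g (x + y) z = g x z + g y z"
    and "x \<in> V \<Longrightarrow> y \<in> V \<Longrightarrow> z \<in> V \<Longrightarrow> g x (y + z) = g x y + g x z"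
    and "x \<in> V \<Longrightarrow> y \<in> V \<Longrightarrow> g (scale c x) y = c * g x y"
    and "x \<in> V \<Longrightarrow> y \<in> V \<Longrightarrow> g x (scale c y) = c * g x y"
    and "x \<in> V \<Longrightarrow> g 0 x = 0"
    and "x \<in> V \<Longrightarrow> g x 0 = 0"
    and "x \<in> V \<Longrightarrow> y \<in> V \<Longrightarrow> g (- x) y = - g x y"
    and "x \<in> V \<Longrightarrow> y \<in> V \<Longrightarrow> g x (- y) = - g x y"
    and "x \<in> V \<Longrightarrow> y \<in> V \<Longrightarrow> z \<in> V \<Longrightarrow> g (x - y) z = g x z - g y z"
    and "x \<in> V \<Longrightarrow> y \<in> V \<Longrightarrow> z \<in> V \<Longrightarrow> g x (y - z) = g x y - g x z"
    and "x \<in> V \<Longrightarrow> (\<And>y. y \<in> V \<Longrightarrow> g x y = 0) \<Longrightarrow> x = 0"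
proof -
  have V: "0 \<in> V" "\<And>x y. x \<in> V \<Longrightarrow> y \<in> V \<Longrightarrow> x + y \<in> V" "\<And>c x. x \<in> V \<Longrightarrow> scale c x \<in> V"
    "\<And>x. x \<in> V \<Longrightarrow> - x \<in> V"
    using assms(1) by (auto simp: subspace_def subspace_neg)
  show sym: "g x y = g y x" if "x \<in> V" "y \<in> V" for x y
    using assms(2) that by (auto simp: metric_on_def)
  show add: "g (x + y) z = g x z + g y z" if "x \<in> V" "y \<in> V" "z \<in> V" for x y z
    using assms(2) that by (auto simp: metric_on_def)
  show scl: "g (scale c x) y = c * g x y" if "x \<in> V" "y \<in> V" for c x y
    using assms(2) that by (auto simp: metric_on_def)
  show add': "g x (y + z) = g x y + g x z" if "x \<in> V" "y \<in> V" "z \<in> V" for x y z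
    using add[of y z x] that V by (simp add: sym)
  show "g x (scale c y) = c * g x y" if "x \<in> V" "y \<in> V" for c x y
    using scl[of y x c] that V by (simp add: sym)
  show z: "g 0 x = 0" if "x \<in> V" for x
    using scl[of x x 0] that by simp
  show "g x 0 = 0" if "x \<in> V" for x
    using z[of x] sym[of x 0] that V by simp
  show n: "g (- x) y = - g x y" if "x \<in> V" "y \<in> V" for x y
    using scl[of x y "- 1"] that by simp
  show n': "g x (- y) = - g x y" if "x \<in> V" "y \<in> V" for x y
    using n[of y x] sym[of x "- y"] sym[of x y] V that by simp
  show "g (x - y) z = g x z - g y z" if "x \<in> V" "y \<in> V" "z \<in> V" for x y z
    using add[of x "- y" z] n that V by simp
  show "g x (y - z) = g x y - g x z" if "x \<in> V" "y \<in> V" "z \<in> V" for x y z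
    using add'[of x y "- z"] n' that V by simp
  show "x = 0" if "x \<in> V" "\<And>y. y \<in> V \<Longrightarrow> g x y = 0" for x
    using assms(2) that by (auto simp: metric_on_def)
qed

lemma metric_on_eqI:
  assumes "subspace V" "metric_on V g" "x \<in> V" "y \<in> V" "\<And>z. z \<in> V \<Longrightarrow> g x z = g y z"
  shows "x = y"
  using metric_onD(12)[OF assms(1,2), of "x - y"] metric_onD(10)[OF assms(1,2)]
    assms subspace_diff[OF assms(1)] by simp

lemma endomorphism_on_UNIV_iff: "endomorphism_on UNIV f \<longleftrightarrow> Vector_Spaces.linear scale scale f"
  by (auto simp: endomorphism_on_def Vector_Spaces.linear_def module_hom_def
      module_hom_axioms_def vector_space_axioms module_axioms)

text \<open>The adjoint of \<open>D\<close> in a decomposition \<open>f = D + D\<^sup>*\<close> need not be constructed: it is \<open>f - D\<close>.\<close>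

lemma solitary_metric_on_iff:
  assumes V: "subspace V"
  shows "solitary_metric_on V g \<longleftrightarrow> ad_invariant_metric_on V g \<and>
    (\<forall>f. ad_invariant_map_on V f \<and> (\<forall>x\<in>V. \<forall>y\<in>V. g (f x) y = g x (f y)) \<longrightarrow>
      (\<exists>D. derivation_on V D \<and> (\<forall>x\<in>V. \<forall>y\<in>V. g (f x) y = g (D x) y + g x (D y))))"
    (is "_ \<longleftrightarrow> ?inv \<and> (\<forall>f. ?sa f \<longrightarrow> (\<exists>D. ?P f D))")
proof (cases ?inv)
  case True
  then have g: "metric_on V g" by (simp add: ad_invariant_metric_on_def)
  note gD = metric_onD[OF V g]
  have sa: "ad_invariant_map_on V f \<and> adjoint_on V g f f \<longleftrightarrow> ?sa f" for f
    by (auto simp: ad_invariant_map_on_def adjoint_on_def)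
  have decomp: "(\<exists>D'. derivation_on V D \<and> adjoint_on V g D D' \<and> (\<forall>x\<in>V. f x = D x + D' x)) \<longleftrightarrow> ?P f D"
    if f: "?sa f" for f D
  proof
    assume "\<exists>D'. derivation_on V D \<and> adjoint_on V g D D' \<and> (\<forall>x\<in>V. f x = D x + D' x)"
    then obtain D' where D: "derivation_on V D" "adjoint_on V g D D'" "\<forall>x\<in>V. f x = D x + D' x"
      by auto
    have "g (f x) y = g (D x) y + g x (D y)" if "x \<in> V" "y \<in> V" for x y
    proof -
      have m: "D x \<in> V" "D' x \<in> V" "D y \<in> V"
        using D that by (auto simp: derivation_on_def adjoint_on_def endomorphism_on_def)
      have "g (D' x) y = g x (D y)"
        using D(2) that gD(1) m by (metis adjoint_on_def)
      then show ?thesis using D(3) m that by (simp add: gD(2-11))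
    qed
    with D(1) show "?P f D" by blast
  next
    assume D: "?P f D"
    have fl: "endomorphism_on V f" and Dl: "endomorphism_on V D"
      using f D by (auto simp: ad_invariant_map_on_def derivation_on_def)
    have "endomorphism_on V (\<lambda>x. f x - D x)"
      using fl Dl subspace_diff[OF V]
      by (simp add: endomorphism_on_def scale_right_diff_distrib)
    moreover have "g (D x) y = g x (f y - D y)" if "x \<in> V" "y \<in> V" for x y
    proof -
      have "f y \<in> V" "D y \<in> V"
        using fl Dl that by (auto simp: endomorphism_on_def)
      moreover have "g x (f y) = g (D x) y + g x (D y)" using f D that by metis
      ultimately show ?thesis using gD(11) that by simp
    qed
    ultimately have "adjoint_on V g D (\<lambda>x. f x - D x)" by (simp add: adjoint_on_def)
    then show "\<exists>D'. derivation_on V D \<and> adjoint_on V g D D' \<and> (\<forall>x\<in>V. f x = D x + D' x)"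
      using D by (intro exI[of _ "\<lambda>x. f x - D x"]) auto
  qed
  show ?thesis
    unfolding solitary_metric_on_def sa
    by (intro conj_cong refl iff_allI imp_cong iff_exI decomp)
qed (simp add: solitary_metric_on_def)

lemma lie_idealD:
  assumes "lie_ideal I"
  shows "subspace I" and "y \<in> I \<Longrightarrow> bracket x y \<in> I" and "x \<in> I \<Longrightarrow> bracket x y \<in> I"
proof -
  show s: "subspace I" and r: "y \<in> I \<Longrightarrow> bracket x y \<in> I" for x y
    using assms by (auto simp: lie_ideal_def)
  show "bracket x y \<in> I" if "x \<in> I" for x y
    using bracket_commute[of x y] r[OF that] subspace_neg[OF s] by simp
qed

end

section \<open>Direct sums of two ideals and their projections\<close>

locale lie_algebra_direct_sum = lie_algebra +
  fixes I J :: "'b set" and p q :: "'b \<Rightarrow> 'b"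
  assumes I: "lie_ideal I" and J: "lie_ideal J" and disj: "I \<inter> J = {0}"
    and p_in [simp]: "p x \<in> I" and q_in [simp]: "q x \<in> J" and p_q: "p x + q x = x"
begin

text \<open>The setting is symmetric in the two summands, so results about \<open>I\<close> transfer
  to \<open>J\<close>.\<close>

lemma swap: "lie_algebra_direct_sum scale bracket J I q p"
  using I J disj p_in q_in p_q
  by unfold_locales (auto simp: add.commute)

lemmas subspace_I = lie_idealD(1)[OF I] and subspace_J = lie_idealD(1)[OF J]

text \<open>Two decompositions of a vector differ by an element of \<open>I \<inter> J\<close>,
  hence agree. This uniqueness is the source of the linearity of \<open>p\<close> and
  \<open>q\<close>, of which the locale assumes only the values.\<close>

lemma proj_eq:
  assumes "x = a + b" "a \<in> I" "b \<in> J"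
  shows "p x = a" "q x = b"
proof -
  have "p x - a = b - q x"
    using p_q[of x] assms(1) by (metis add.commute add_diff_eq diff_add_cancel)
  moreover have "p x - a \<in> I" "b - q x \<in> J"
    using assms subspace_I subspace_J by (auto intro: subspace_diff)
  ultimately have "p x - a \<in> I \<inter> J" "b - q x \<in> I \<inter> J" by auto
  then show "p x = a" "q x = b" using disj by auto
qed

lemma proj_simps [simp]:
  "p (x + y) = p x + p y" "q (x + y) = q x + q y"
  "p (scale c x) = scale c (p x)" "q (scale c x) = scale c (q x)"
  "x \<in> I \<Longrightarrow> p x = x" "x \<in> I \<Longrightarrow> q x = 0" "x \<in> J \<Longrightarrow> p x = 0" "x \<in> J \<Longrightarrow> q x = x"
proof -
  show "p (x + y) = p x + p y" "q (x + y) = q x + q y"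
    using proj_eq[of "x + y" "p x + p y" "q x + q y"] p_q[of x] p_q[of y]
    by (simp_all add: subspace_add subspace_I subspace_J add.assoc add.left_commute)
  show "p (scale c x) = scale c (p x)" "q (scale c x) = scale c (q x)"
    using proj_eq[of "scale c x" "scale c (p x)" "scale c (q x)"] p_q[of x]
    by (simp_all add: subspace_scale subspace_I subspace_J flip: scale_right_distrib)
  show "x \<in> I \<Longrightarrow> p x = x" "x \<in> I \<Longrightarrow> q x = 0"
    using proj_eq[of x x 0] by (simp_all add: subspace_0 subspace_J)
  show "x \<in> J \<Longrightarrow> p x = 0" "x \<in> J \<Longrightarrow> q x = x"
    using proj_eq[of x 0 x] by (simp_all add: subspace_0 subspace_I)
qed

text \<open>The bracket lies in both ideals, hence in their trivial intersection.\<close>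

lemma bracket_I_J [simp]:
  assumes "x \<in> I" "y \<in> J" shows "bracket x y = 0" "bracket y x = 0"
  using lie_idealD(2,3)[OF I] lie_idealD(2,3)[OF J] assms disj by blast+

lemma bracket_I: "x \<in> I \<Longrightarrow> bracket x y = bracket x (p y)" "x \<in> I \<Longrightarrow> bracket y x = bracket (p y) x"
  using bracket_simps(2)[of x "p y" "q y"] bracket_simps(1)[of "p y" "q y" x]
  by (simp_all add: p_q del: bracket_simps)

lemma bracket_J: "x \<in> J \<Longrightarrow> bracket x y = bracket x (q y)" "x \<in> J \<Longrightarrow> bracket y x = bracket (q y) x"
  using bracket_simps(2)[of x "p y" "q y"] bracket_simps(1)[of "p y" "q y" x]
  by (simp_all add: p_q del: bracket_simps)

text \<open>Mixed brackets vanish, so both projections are Lie algebra homomorphisms.\<close>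

lemma proj_bracket [simp]:
  "p (bracket x y) = bracket (p x) (p y)" "q (bracket x y) = bracket (q x) (q y)"
proof -
  have "bracket x y = bracket (p x + q x) y" by (simp add: p_q)
  also have "\<dots> = bracket (p x) (p y) + bracket (q x) (q y)"
    using bracket_I(1)[of "p x" y] bracket_J(1)[of "q x" y] by simp
  finally show "p (bracket x y) = bracket (p x) (p y)" "q (bracket x y) = bracket (q x) (q y)"
    using proj_eq lie_idealD[OF I] lie_idealD[OF J] by simp_all
qed

section \<open>Orthogonal sums of metrics on the two ideals\<close>

definition sum_form :: "('b \<Rightarrow> 'b \<Rightarrow> 'a) \<Rightarrow> ('b \<Rightarrow> 'b \<Rightarrow> 'a) \<Rightarrow> 'b \<Rightarrow> 'b \<Rightarrow> 'a" where
  "sum_form g h x y = g (p x) (p y) + h (q x) (q y)"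

text \<open>Invariance is inherited because \<open>p\<close> and \<open>q\<close> are homomorphisms.
  Nondegeneracy is tested on one summand at a time, where the other form contributes
  nothing.\<close>

lemma ad_invariant_metric_on_sum_form:
  assumes g: "ad_invariant_metric_on I g" and h: "ad_invariant_metric_on J h"
  shows "ad_invariant_metric_on UNIV (sum_form g h)"
proof -
  note gD = metric_onD[OF subspace_I conjunct1[OF g[unfolded ad_invariant_metric_on_def]]]
  note hD = metric_onD[OF subspace_J conjunct1[OF h[unfolded ad_invariant_metric_on_def]]]
  show ?thesis
    unfolding ad_invariant_metric_on_def metric_on_def
  proof (intro conjI ballI allI impI)
    show "sum_form g h x y = sum_form g h y x" for x y
      by (simp add: sum_form_def gD(1)[of "p x"] hD(1)[of "q x"])
    show "sum_form g h (x + y) z = sum_form g h x z + sum_form g h y z" for x y z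
      by (simp add: sum_form_def gD(2-11) hD(2-11))
    show "sum_form g h (scale c x) y = c * sum_form g h x y" for c x y
      by (simp add: sum_form_def gD(2-11) hD(2-11) algebra_simps)
    show "x = 0" if "\<forall>y\<in>UNIV. sum_form g h x y = 0" for x
    proof -
      have "g (p x) y = 0" if "y \<in> I" for y
        using \<open>\<forall>y\<in>UNIV. sum_form g h x y = 0\<close>[rule_format, of y] that
        by (simp add: sum_form_def hD(2-11))
      then have "p x = 0" using gD(12)[of "p x"] by simp
      moreover have "h (q x) y = 0" if "y \<in> J" for y
        using \<open>\<forall>y\<in>UNIV. sum_form g h x y = 0\<close>[rule_format, of y] that
        by (simp add: sum_form_def gD(2-11))
      then have "q x = 0" using hD(12)[of "q x"] by simp
      ultimately show "x = 0" using p_q[of x] by simp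
    qed
    show "sum_form g h (bracket x y) z = - sum_form g h y (bracket x z)" for x y z
      using g h by (simp add: sum_form_def ad_invariant_metric_on_def)
  qed
qed

text \<open>
  Besides the derivations of the two summands, the off-diagonal block \<open>q \<circ> f \<circ> p\<close> is used: it
  kills commutators and has central image, so it is itself a derivation, and its adjoint is the
  other off-diagonal block \<open>p \<circ> f \<circ> q\<close>.
\<close>

lemma solitary_metric_on_sum_form:
  assumes g: "solitary_metric_on I g" and h: "solitary_metric_on J h"
  shows "solitary_metric_on UNIV (sum_form g h)"
proof -
  note gs = g[unfolded solitary_metric_on_iff[OF subspace_I]]
  note hs = h[unfolded solitary_metric_on_iff[OF subspace_J]]
  note gD = metric_onD[OF subspace_I conjunct1[OF conjunct1[OF gs, unfolded ad_invariant_metric_on_def]]]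
  note hD = metric_onD[OF subspace_J conjunct1[OF conjunct1[OF hs, unfolded ad_invariant_metric_on_def]]]
  have "\<exists>D. derivation_on UNIV D \<and>
      (\<forall>x y. sum_form g h (f x) y = sum_form g h (D x) y + sum_form g h x (D y))"
    if f: "ad_invariant_map_on UNIV f" and sa: "\<And>x y. sum_form g h (f x) y = sum_form g h x (f y)" for f
  proof -
    have f_add: "f (x + y) = f x + f y" and f_scale: "f (scale c x) = scale c (f x)"
      and f_br: "f (bracket x y) = bracket x (f y)" for x y c
      using f by (auto simp: ad_invariant_map_on_def endomorphism_on_def)
    \<comment> \<open>The diagonal block inherits both properties of \<open>f\<close>:
      \<open>p\<close> is a homomorphism fixing \<open>I\<close>, and on vectors of \<open>I\<close>
      the \<open>h\<close> part of the form drops out.\<close>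
    have "ad_invariant_map_on I (\<lambda>x. p (f x))"
      by (simp add: ad_invariant_map_on_def endomorphism_on_def f_add f_scale f_br)
    moreover have "g (p (f x)) y = g x (p (f y))" if "x \<in> I" "y \<in> I" for x y
      using sa[of x y] that by (simp add: sum_form_def hD(2-11))
    ultimately obtain D1 where D1: "derivation_on I D1"
      "\<forall>x\<in>I. \<forall>y\<in>I. g (p (f x)) y = g (D1 x) y + g x (D1 y)"
      using gs by blast
    have "ad_invariant_map_on J (\<lambda>x. q (f x))"
      by (simp add: ad_invariant_map_on_def endomorphism_on_def f_add f_scale f_br)
    moreover have "h (q (f x)) y = h x (q (f y))" if "x \<in> J" "y \<in> J" for x y
      using sa[of x y] that by (simp add: sum_form_def gD(2-11))
    ultimately obtain D2 where D2: "derivation_on J D2"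
      "\<forall>x\<in>J. \<forall>y\<in>J. h (q (f x)) y = h (D2 x) y + h x (D2 y)"
      using hs by blast
    \<comment> \<open>Only one off-diagonal block enters: the adjoint of \<open>D\<close> supplies
      the other, and including both would count each of them twice.\<close>
    define D where "D x = D1 (p x) + D2 (q x) + q (f (p x))" for x
    have D1': "\<And>x. x \<in> I \<Longrightarrow> D1 x \<in> I"
      "\<And>x y. x \<in> I \<Longrightarrow> y \<in> I \<Longrightarrow> D1 (x + y) = D1 x + D1 y"
      "\<And>c x. x \<in> I \<Longrightarrow> D1 (scale c x) = scale c (D1 x)"
      "\<And>x y. x \<in> I \<Longrightarrow> y \<in> I \<Longrightarrow> D1 (bracket x y) = bracket (D1 x) y + bracket x (D1 y)"
      using D1 by (auto simp: derivation_on_def endomorphism_on_def)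
    have D2': "\<And>x. x \<in> J \<Longrightarrow> D2 x \<in> J"
      "\<And>x y. x \<in> J \<Longrightarrow> y \<in> J \<Longrightarrow> D2 (x + y) = D2 x + D2 y"
      "\<And>c x. x \<in> J \<Longrightarrow> D2 (scale c x) = scale c (D2 x)"
      "\<And>x y. x \<in> J \<Longrightarrow> y \<in> J \<Longrightarrow> D2 (bracket x y) = bracket (D2 x) y + bracket x (D2 y)"
      using D2 by (auto simp: derivation_on_def endomorphism_on_def)
    \<comment> \<open>Only the \<open>J\<close> component of \<open>x\<close> acts on a vector of
      \<open>J\<close>. Ad-invariance moves this bracket inside \<open>f\<close>, where it pairs
      \<open>J\<close> with \<open>I\<close>.\<close>
    have central: "bracket x (q (f (p y))) = 0" for x y
    proof -
      have "bracket x (q (f (p y))) = bracket (q x) (q (f (p y)))"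
        by (rule bracket_J) simp
      also have "\<dots> = q (f (bracket (q x) (p y)))"
        by (simp add: f_br del: bracket_I_J)
      also have "\<dots> = 0" using f_scale[of 0 0] by (simp add: subspace_0 subspace_J)
      finally show ?thesis .
    qed
    then have central': "bracket (q (f (p y))) x = 0" for x y
      by (subst bracket_commute) simp
    \<comment> \<open>By ad-invariance the image under \<open>f\<close> is
      \<open>bracket (p x) (f (p y))\<close>, which stays in the ideal \<open>I\<close>.\<close>
    have comm: "q (f (bracket (p x) (p y))) = 0" for x y
      by (simp add: f_br subspace_0 subspace_J)
    have "D (bracket x y) = bracket (D x) y + bracket x (D y)" for x y
    proof -
      have "bracket (D1 (p x)) y = bracket (D1 (p x)) (p y)" "bracket x (D1 (p y)) = bracket (p x) (D1 (p y))"
        "bracket (D2 (q x)) y = bracket (D2 (q x)) (q y)" "bracket x (D2 (q y)) = bracket (q x) (D2 (q y))"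
        using bracket_I[of "D1 (p _)"] bracket_J[of "D2 (q _)"] D1'(1) D2'(1) by simp_all
      then show ?thesis
        by (simp add: D_def D1'(4) D2'(4) central central' comm)
    qed
    moreover have "D (x + y) = D x + D y" "D (scale c x) = scale c (D x)" for x y c
      by (simp_all add: D_def D1' D2' f_add f_scale scale_right_distrib)
    ultimately have "derivation_on UNIV D" by (simp add: derivation_on_def endomorphism_on_def)
    moreover have "sum_form g h (f x) y = sum_form g h (D x) y + sum_form g h x (D y)" for x y
    proof -
      have pD: "p (D z) = D1 (p z)" and qD: "q (D z) = D2 (q z) + q (f (p z))" for z
        using D1' D2' by (simp_all add: D_def)
      have f_pq: "f x = f (p x) + f (q x)" using p_q[of x] f_add[of "p x" "q x"] by simp
      have "g (p (f (q x))) (p y) = h (q x) (q (f (p y)))"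
        using sa[of "q x" "p y"] by (simp add: sum_form_def gD(2-11) hD(2-11))
      moreover have "g (p (f (p x))) (p y) = g (D1 (p x)) (p y) + g (p x) (D1 (p y))"
        "h (q (f (q x))) (q y) = h (D2 (q x)) (q y) + h (q x) (D2 (q y))"
        using D1(2) D2(2) by auto
      ultimately show ?thesis
        using D1'(1) D2'(1) by (simp add: sum_form_def f_pq pD qD gD(2-11) hD(2-11))
    qed
    ultimately show ?thesis by blast
  qed
  then show ?thesis
    using gs hs ad_invariant_metric_on_sum_form by (simp add: solitary_metric_on_iff)
qed

text \<open>A map \<open>f\<close> on \<open>I\<close> is extended by zero on \<open>J\<close>, as
  \<open>f \<circ> p\<close>. The derivation obtained on the whole algebra is compressed back to
  \<open>p \<circ> D\<close> on \<open>I\<close>, again a derivation because \<open>p\<close> is a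
  homomorphism fixing \<open>I\<close>.\<close>

lemma solitary_metric_on_I_if_sum_form:
  assumes g: "ad_invariant_metric_on I g" and h: "ad_invariant_metric_on J h"
    and s: "solitary_metric_on UNIV (sum_form g h)"
  shows "solitary_metric_on I g"
proof -
  note gD = metric_onD[OF subspace_I conjunct1[OF g[unfolded ad_invariant_metric_on_def]]]
  note hD = metric_onD[OF subspace_J conjunct1[OF h[unfolded ad_invariant_metric_on_def]]]
  have "\<exists>D. derivation_on I D \<and> (\<forall>x\<in>I. \<forall>y\<in>I. g (f x) y = g (D x) y + g x (D y))"
    if f: "ad_invariant_map_on I f" and sa: "\<forall>x\<in>I. \<forall>y\<in>I. g (f x) y = g x (f y)" for f
  proof -
    have f': "\<And>x. x \<in> I \<Longrightarrow> f x \<in> I"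
      "\<And>x y. x \<in> I \<Longrightarrow> y \<in> I \<Longrightarrow> f (x + y) = f x + f y"
      "\<And>c x. x \<in> I \<Longrightarrow> f (scale c x) = scale c (f x)"
      "\<And>x y. x \<in> I \<Longrightarrow> y \<in> I \<Longrightarrow> f (bracket x y) = bracket x (f y)"
      using f by (auto simp: ad_invariant_map_on_def endomorphism_on_def)
    \<comment> \<open>The extension is ad-invariant for all \<open>x\<close> because its values lie
      in \<open>I\<close>, on which \<open>x\<close> acts through \<open>p x\<close> alone.\<close>
    have "bracket x (f (p y)) = bracket (p x) (f (p y))" for x y
      by (rule bracket_I(2)) (rule f'(1)[OF p_in])
    then have "ad_invariant_map_on UNIV (\<lambda>x. f (p x))"
      by (simp add: ad_invariant_map_on_def endomorphism_on_def f')
    moreover have "sum_form g h (f (p x)) y = sum_form g h x (f (p y))" for x y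
      using sa f'(1) by (simp add: sum_form_def hD(2-11))
    ultimately obtain D where D: "derivation_on UNIV D"
      "\<And>x y. sum_form g h (f (p x)) y = sum_form g h (D x) y + sum_form g h x (D y)"
      using s by (simp add: solitary_metric_on_iff) blast
    have "derivation_on I (\<lambda>x. p (D x))"
      using D(1) by (simp add: derivation_on_def endomorphism_on_def)
    moreover have "g (f x) y = g (p (D x)) y + g x (p (D y))" if "x \<in> I" "y \<in> I" for x y
      using D(2)[of x y] f'(1) that
      by (simp add: sum_form_def hD(2-11) subspace_0 subspace_J)
    ultimately show ?thesis by blast
  qed
  then show ?thesis using g by (simp add: solitary_metric_on_iff subspace_I)
qed

end

section \<open>Finite dimension: independence of the chosen metric\<close>

locale finite_dimensional_lie_algebra =
  lie_algebra scale bracket + finite_dimensional_vector_space scale Basis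
  for scale :: "'k::field \<Rightarrow> 'v::ab_group_add \<Rightarrow> 'v" and bracket Basis
begin

text \<open>Nondegeneracy makes \<open>x \<mapsto> b x\<close> injective into the dual space, hence
  surjective in finite dimension; \<open>T x\<close> is the preimage of the functional
  \<open>h x\<close>.\<close>

lemma form_representation:
  assumes b: "metric_on UNIV b"
    and h: "\<And>x x' y. h (x + x') y = h x y + h x' y" "\<And>c x y. h (scale c x) y = c * h x y"
      "\<And>x y y'. h x (y + y') = h x y + h x y'" "\<And>c x y. h x (scale c y) = c * h x y"
  obtains T where "Vector_Spaces.linear scale scale T" "\<And>x y. b (T x) y = h x y"
proof -
  note bD = metric_onD[OF subspace_UNIV b, simplified]
  note bD(2-11) [simp]
  \<comment> \<open>The functional \<open>b x\<close> is encoded as the vector whose coordinates are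
    its values on the basis. This makes \<open>F\<close> an endomorphism, for which injectivity
    implies surjectivity.\<close>
  define F where "F x = (\<Sum>e\<in>Basis. scale (b x e) e)" for x
  have coeff: "\<And>e. e \<in> Basis \<Longrightarrow> c e = d e"
    if "(\<Sum>e\<in>Basis. scale (c e) e) = (\<Sum>e\<in>Basis. scale (d e) e)" for c d
  proof -
    have "(\<Sum>e\<in>Basis. scale (c e - d e) e) = 0"
      using that by (simp add: scale_left_diff_distrib sum_subtractf)
    then show "c e = d e" if "e \<in> Basis" for e
      using independentD[OF independent_Basis finite_Basis subset_refl _ that, of "\<lambda>e. c e - d e"] by simp
  qed
  have ext: "\<phi> y = \<psi> y" if "\<And>e. e \<in> Basis \<Longrightarrow> \<phi> e = \<psi> e"
    "\<And>y y'. \<phi> (y + y') = \<phi> y + \<phi> y'" "\<And>c y. \<phi> (scale c y) = c * \<phi> y"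
    "\<And>y y'. \<psi> (y + y') = \<psi> y + \<psi> y'" "\<And>c y. \<psi> (scale c y) = c * \<psi> y"
    for \<phi> \<psi> :: "'v \<Rightarrow> 'k" and y
  proof -
    have "y \<in> span Basis" using span_Basis by simp
    then show ?thesis
    proof (induction rule: span_induct_alt)
      case base
      show ?case using that(3)[of 0 0] that(5)[of 0 0] by simp
    qed (simp add: that)
  qed
  have F_lin: "Vector_Spaces.linear scale scale F"
    by (simp flip: endomorphism_on_UNIV_iff)
      (simp add: endomorphism_on_def F_def sum.distrib scale_left_distrib scale_sum_right)
  have "inj F"
  proof (rule injI)
    fix x y assume "F x = F y"
    then have "b x e = b y e" if "e \<in> Basis" for e
      using coeff[of "b x" "b y"] that by (simp add: F_def)
    then have "b x z = b y z" for z by (rule ext) simp_all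
    then show "x = y" by (intro metric_on_eqI[OF subspace_UNIV b]) simp_all
  qed
  then have "surj F" using F_lin linear_inj_imp_surj by blast
  then have "\<exists>t. F t = (\<Sum>e\<in>Basis. scale (h x e) e)" for x by (metis surjD)
  then obtain T where "\<And>x. F (T x) = (\<Sum>e\<in>Basis. scale (h x e) e)" by metis
  then have "b (T x) e = h x e" if "e \<in> Basis" for x e
    using coeff[of "b (T x)" "h x"] that by (simp add: F_def)
  then have T: "b (T x) y = h x y" for x y
    by (rule ext) (simp_all add: h)
  \<comment> \<open>\<open>T\<close> was chosen pointwise; testing against \<open>b\<close> recovers
    its linearity.\<close>
  have "T (x + y) = T x + T y" "T (scale c x) = scale c (T x)" for x y c
    by (rule metric_on_eqI[OF subspace_UNIV b]; simp add: T h)+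
  then have "Vector_Spaces.linear scale scale T"
    by (simp flip: endomorphism_on_UNIV_iff) (simp add: endomorphism_on_def)
  then show thesis using T that by blast
qed

text \<open>\<open>S\<close> and \<open>T\<close> convert the two metrics into each other. If
  \<open>f\<close> is self-adjoint for \<open>c\<close>, then \<open>S \<circ> f\<close> is so for
  \<open>b\<close>; a derivation \<open>D\<close> splitting \<open>S \<circ> f\<close> yields
  \<open>T \<circ> D\<close> splitting \<open>f\<close>, as
  \<open>c (T (D x)) y = b (D x) y\<close>.\<close>

lemma solitary_metric_on_UNIV_independent:
  assumes b: "solitary_metric_on UNIV b" and c: "ad_invariant_metric_on UNIV c"
  shows "solitary_metric_on UNIV c"
proof -
  note bs = b[unfolded solitary_metric_on_iff[OF subspace_UNIV]]
  have bm: "metric_on UNIV b" and cm: "metric_on UNIV c"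
    and b_inv: "\<And>x y z. b (bracket x y) z = - b y (bracket x z)"
    and c_inv: "\<And>x y z. c (bracket x y) z = - c y (bracket x z)"
    using bs c by (auto simp: ad_invariant_metric_on_def)
  note bD = metric_onD[OF subspace_UNIV bm, simplified]
  note cD = metric_onD[OF subspace_UNIV cm, simplified]
  obtain S where S: "Vector_Spaces.linear scale scale S" "\<And>x y. b (S x) y = c x y"
    by (rule form_representation[OF bm, of c]) (auto simp: cD(2-11))
  obtain T where T: "Vector_Spaces.linear scale scale T" "\<And>x y. c (T x) y = b x y"
    by (rule form_representation[OF cm, of b]) (auto simp: bD(2-11))
  interpret T: Vector_Spaces.linear scale scale T by (rule T)
  have S_br: "S (bracket x y) = bracket x (S y)" for x y
    by (rule metric_on_eqI[OF subspace_UNIV bm]) (simp_all add: S c_inv b_inv)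
  have T_br: "T (bracket x y) = bracket x (T y)" for x y
    by (rule metric_on_eqI[OF subspace_UNIV cm]) (simp_all add: T c_inv b_inv)
  \<comment> \<open>In the product rule for \<open>T \<circ> D\<close>, \<open>T\<close> must reach
    whichever factor carries \<open>D\<close>, so it has to pass into either side of the
    bracket.\<close>
  have T_br': "T (bracket x y) = bracket (T x) y" for x y
    using T_br[of y x] bracket_commute[of x y] bracket_commute[of "T x" y] T.neg by simp
  have "\<exists>D. derivation_on UNIV D \<and> (\<forall>x y. c (f x) y = c (D x) y + c x (D y))"
    if f: "ad_invariant_map_on UNIV f" and sa: "\<And>x y. c (f x) y = c x (f y)" for f
  proof -
    have fl: "Vector_Spaces.linear scale scale f" and f_br: "\<And>x y. f (bracket x y) = bracket x (f y)"
      using f by (auto simp: ad_invariant_map_on_def endomorphism_on_UNIV_iff)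
    have "ad_invariant_map_on UNIV (S \<circ> f)"
      using fl S by (simp add: ad_invariant_map_on_def endomorphism_on_UNIV_iff Vector_Spaces.linear_compose f_br S_br)
    moreover have "b ((S \<circ> f) x) y = b x ((S \<circ> f) y)" for x y
      using sa[of x y] S(2)[of "f y" x] bD(1)[of x] cD(1)[of x] by (simp add: S)
    ultimately obtain D where D: "derivation_on UNIV D"
      "\<And>x y. b ((S \<circ> f) x) y = b (D x) y + b x (D y)"
      using bs by (metis UNIV_I)
    have Dl: "Vector_Spaces.linear scale scale D"
      and D_br: "\<And>x y. D (bracket x y) = bracket (D x) y + bracket x (D y)"
      using D(1) by (auto simp: derivation_on_def endomorphism_on_UNIV_iff)
    have "derivation_on UNIV (T \<circ> D)"
      using Dl T(1) by (simp add: derivation_on_def endomorphism_on_UNIV_iff Vector_Spaces.linear_compose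
          D_br T.add T_br') (metis T_br T_br')
    moreover have "c (f x) y = c ((T \<circ> D) x) y + c x ((T \<circ> D) y)" for x y
      using D(2)[of x y] T(2)[of "D y" x] bD(1)[of x] cD(1)[of x] by (simp add: S T)
    ultimately show ?thesis by blast
  qed
  then show ?thesis using c by (simp add: solitary_metric_on_iff)
qed

end

section \<open>Invariant metrics on the summands and the equivalence\<close>

locale finite_dimensional_lie_algebra_direct_sum =
  finite_dimensional_lie_algebra scale bracket Basis + lie_algebra_direct_sum scale bracket I J p q
  for scale :: "'k::field \<Rightarrow> 'v::ab_group_add \<Rightarrow> 'v" and bracket Basis I J p q
begin

lemma fd_swap: "finite_dimensional_lie_algebra_direct_sum scale bracket Basis J I q p"
  by (intro finite_dimensional_lie_algebra_direct_sum.intro finite_dimensional_lie_algebra_axioms swap)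

text \<open>
  The restriction of \<open>b\<close> to \<open>I\<close> can be degenerate, as \<open>I\<close> and \<open>J\<close> need not be orthogonal. Its
  radical \<open>R\<close> is, however, central and meets \<open>[I, I]\<close> trivially, since \<open>[I, I]\<close> is orthogonal to
  \<open>J\<close>; so one may add any nondegenerate form on \<open>R\<close>, pulled back along a projection onto \<open>R\<close>
  that kills \<open>[I, I]\<close>.
\<close>

lemma ad_invariant_metric_on_I:
  assumes b: "ad_invariant_metric_on UNIV b"
  obtains g where "ad_invariant_metric_on I g"
proof -
  have bm: "metric_on UNIV b" and b_inv: "\<And>x y z. b (bracket x y) z = - b y (bracket x z)"
    using b by (auto simp: ad_invariant_metric_on_def)
  note bD = metric_onD[OF subspace_UNIV bm, simplified]
  define R where "R = {x\<in>I. \<forall>y\<in>I. b x y = 0}"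
  have R: "subspace R"
    using subspace_I by (auto simp: R_def subspace_def bD(2-11))
  \<comment> \<open>\<open>T\<close> is the \<open>b\<close>-adjoint of the projection
    \<open>q\<close>. It kills \<open>[I, I]\<close>, which is orthogonal to \<open>J\<close>, and
    is injective on \<open>R\<close>; a left inverse on \<open>R\<close> then turns it into the
    required projection.\<close>
  obtain T where T: "Vector_Spaces.linear scale scale T" "\<And>x y. b (T x) y = b x (q y)"
    by (rule form_representation[OF bm, of "\<lambda>x y. b x (q y)"]) (auto simp: bD(2-11))
  have T_br: "T (bracket x y) = 0" if "x \<in> I" "y \<in> I" for x y
    using that by (intro bD(12)) (simp add: T b_inv bD(2-11))
  interpret vector_space_pair scale scale ..
  \<comment> \<open>Such a vector is orthogonal to \<open>I\<close> by membership in
    \<open>R\<close> and to \<open>J\<close> by \<open>T x = 0\<close>.\<close>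
  have "x = 0" if "x \<in> R" "T x = 0" for x
  proof (rule bD(12))
    fix y
    have "b x y = b x (p y) + b x (q y)" using bD(3)[of x "p y" "q y"] by (simp add: p_q)
    also have "b x (p y) = 0" using that by (simp add: R_def)
    also have "b x (q y) = 0" using T(2)[of x y] that by (simp add: bD(2-11))
    finally show "b x y = 0" by simp
  qed
  then have "inj_on T R" by (simp add: linear_inj_on_iff_eq_0[OF T(1) R])
  then obtain S where S: "S ` UNIV \<subseteq> R" "Vector_Spaces.linear scale scale S" "\<And>x. x \<in> R \<Longrightarrow> S (T x) = x"
    using linear_exists_left_inverse_on[OF T(1) R] by auto
  obtain B where B: "B \<subseteq> R" "independent B" "R \<subseteq> span B"
    using maximal_independent_subset by blast
  have finB: "finite B" using B(2) by (rule finiteI_independent)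
  interpret T: Vector_Spaces.linear scale scale T by (rule T)
  interpret S: Vector_Spaces.linear scale scale S by (rule S)
  have span: "S x \<in> span B" for x using S(1) B(3) by auto
  \<comment> \<open>Coordinates, in the basis \<open>B\<close> of \<open>R\<close>, of the
    projection \<open>S \<circ> T\<close> onto \<open>R\<close>.\<close>
  define k where "k x e = representation B (S (T x)) e" for x e
  have k_add: "k (x + y) e = k x e + k y e" and k_scale: "k (scale c x) e = c * k x e" for x y c e
    by (simp_all add: k_def T.add S.add T.scale S.scale representation_add representation_scale B(2) span)
  have k_br: "k (bracket x y) e = 0" if "x \<in> I" "y \<in> I" for x y e
    using that by (simp add: k_def T_br representation_zero)
  have k_B: "k d e = (if e = d then 1 else 0)" if "d \<in> B" for d e
    using that B by (auto simp: k_def S(3) subsetD representation_basis)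
  \<comment> \<open>The added sum is the bilinear form on \<open>R\<close> with \<open>B\<close>
    orthonormal, pulled back along \<open>S \<circ> T\<close>.\<close>
  define g where "g x y = b x y + (\<Sum>e\<in>B. k x e * k y e)" for x y
  have "x = 0" if x: "x \<in> I" "\<forall>y\<in>I. g x y = 0" for x
  proof -
    \<comment> \<open>Against \<open>d\<close> in the radical the \<open>b\<close> term vanishes,
      and the sum reduces to the single coordinate \<open>k x d\<close>.\<close>
    have "k x d = 0" if d: "d \<in> B" for d
    proof -
      have dR: "d \<in> R" using d B by auto
      have "g x d = (\<Sum>e\<in>B. k x e * k d e)"
        using dR x(1) bD(1)[of x d] by (simp add: g_def R_def)
      also have "\<dots> = k x d" using d finB by (simp add: k_B[OF d] if_distrib cong: if_cong)
      finally show ?thesis using x(2) dR by (simp add: R_def)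
    qed
    \<comment> \<open>With all coordinates zero, \<open>g x\<close> agrees with \<open>b x\<close>,
      so \<open>x\<close> lies in the radical; there \<open>S \<circ> T\<close> is the identity and
      the vanishing coordinates are those of \<open>x\<close> itself.\<close>
    moreover from this have "x \<in> R" using x by (simp add: R_def g_def)
    ultimately have "representation B x e = 0" if "e \<in> B" for e
      using that S(3)[of x] by (simp add: k_def)
    then show "x = 0"
      using sum_representation_eq[OF B(2) _ finB subset_refl, of x] B(3) \<open>x \<in> R\<close> by auto
  qed
  moreover have "g x y = g y x" "g (x + y) z = g x z + g y z" "g (scale c x) y = c * g x y" for x y z c
    using bD(1)[of x y]
    by (simp_all add: g_def bD(2-11) k_add k_scale algebra_simps sum.distrib sum_distrib_left)
  moreover have "g (bracket x y) z = - g y (bracket x z)" if "x \<in> I" "y \<in> I" "z \<in> I" for x y z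
    using that by (simp add: g_def b_inv k_br)
  ultimately have "ad_invariant_metric_on I g"
    unfolding ad_invariant_metric_on_def metric_on_def by blast
  then show thesis by (rule that)
qed

text \<open>The given solitary metric need not make \<open>I\<close> and \<open>J\<close>
  orthogonal. It is replaced by the orthogonal sum of invariant metrics on the two summands, which
  is solitary by independence of the metric and can be restricted to \<open>I\<close>.\<close>

lemma solitary_on_I:
  assumes "solitary_on UNIV"
  shows "solitary_on I"
proof -
  interpret sw: finite_dimensional_lie_algebra_direct_sum scale bracket Basis J I q p
    by (rule fd_swap)
  obtain b where b: "solitary_metric_on UNIV b" using assms by (auto simp: solitary_on_def)
  then have bi: "ad_invariant_metric_on UNIV b" by (simp add: solitary_metric_on_def)
  obtain g where g: "ad_invariant_metric_on I g" using bi by (rule ad_invariant_metric_on_I)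
  obtain h where h: "ad_invariant_metric_on J h" using bi by (rule sw.ad_invariant_metric_on_I)
  have "solitary_metric_on UNIV (sum_form g h)"
    using b ad_invariant_metric_on_sum_form[OF g h] by (rule solitary_metric_on_UNIV_independent)
  then show ?thesis
    using solitary_metric_on_I_if_sum_form[OF g h] by (auto simp: solitary_on_def)
qed

lemma solitary_on_UNIV_iff: "solitary_on UNIV \<longleftrightarrow> solitary_on I \<and> solitary_on J"
proof -
  interpret sw: finite_dimensional_lie_algebra_direct_sum scale bracket Basis J I q p
    by (rule fd_swap)
  show ?thesis
    using solitary_on_I sw.solitary_on_I solitary_metric_on_sum_form
    unfolding solitary_on_def by blast
qed

end

theorem proposition2p23:
  fixes scale :: "'k::real_or_complex \<Rightarrow> 'v::ab_group_add \<Rightarrow> 'v"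
    and bracket :: "'v \<Rightarrow> 'v \<Rightarrow> 'v"
    and Basis :: "'v set"
    and g1 g2 :: "'v set"
  assumes "lie_algebra scale bracket"
    and "finite_dimensional_vector_space scale Basis"
    and "lie_algebra.lie_ideal scale bracket g1" and "lie_algebra.lie_ideal scale bracket g2"
    and "g1 \<noteq> {0}" and "g2 \<noteq> {0}"
    and "g1 \<inter> g2 = {0}" and "\<forall>x. \<exists>y\<in>g1. \<exists>z\<in>g2. x = y + z"
  shows "lie_algebra.solitary_on scale bracket UNIV \<longleftrightarrow>
         lie_algebra.solitary_on scale bracket g1 \<and> lie_algebra.solitary_on scale bracket g2"
proof -
  interpret lie_algebra scale bracket by fact
  interpret finite_dimensional_vector_space scale Basis by fact
  \<comment> \<open>Components are picked by choice; uniqueness of decompositions makes them the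
    linear projections.\<close>
  obtain p q where "\<And>x. p x \<in> g1" "\<And>x. q x \<in> g2" "\<And>x. p x + q x = x"
    using assms(8) by metis
  then interpret finite_dimensional_lie_algebra_direct_sum scale bracket Basis g1 g2 p q
    using assms by unfold_locales auto
  show ?thesis by (rule solitary_on_UNIV_iff)
qed

end
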